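(* Let $n\geq 20$ be an integer such that neither $n$ nor $n-1$ is a prime. If $n=p_1^{k_1}+p_2^{k_2}$, where $p_1,p_2$ are primes with $5\leq p_1<p_2$ and $k_1,k_2$ are positive integers, then $\operatorname{diam}(\Delta^o(S_n)^* )=3$.
   Context: $S_n$ is the symmetric group of degree $n$. For a finite group $G$, $o(g)$ denotes the order of $g\in G$, and the order super commuting graph $\Delta^o(G)$ is the simple undirected graph with vertex set $G$ in which two distinct elements $g,h$ are adjacent iff either $o(g)=o(h)$, or there exist $g',h'\in G$ with $o(g')=o(g)$, $o(h')=o(h)$ such that $g'$ and $h'$ are distinct and commute. A vertex is dominant if it is adjacent to every other vertex. The reduced order super commuting graph $\Delta^o(G)^*$ is the induced subgraph of $\Delta^o(G)$ obtained by deleting all dominant vertices of $\Delta^o(G)$. The diameter $\operatorname{diam}$ of a connected graph is the maximum distance between two of its vertices (saying the diameter equals $3$ includes that the graph is connected). *)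

theory Defs
  imports
    "HOL-Computational_Algebra.Primes"
    "HOL-Algebra.Sym_Groups"
    "HOL-Algebra.Multiplicative_Group"
    "Graph_Theory.Digraph_Component"
    "Graph_Theory.Pair_Digraph"
    "Graph_Theory.Shortest_Path"
begin

text \<open>
  Following the conventions of the entry Graph-Theory, a simple undirected graph is a finite
  symmetric loop-free digraph without parallel arcs, i.e. it satisfies \<^locale>\<open>graph\<close> (respectively
  \<^locale>\<open>pair_graph\<close>); an edge is represented by its two orientations.
\<close>

definition order_super_commuting_graph :: "('a, 'b) monoid_scheme \<Rightarrow> 'a pair_pre_digraph" where
  "order_super_commuting_graph G =
     \<lparr> pverts = carrier G,
       parcs = {(g, h). g \<in> carrier G \<and> h \<in> carrier G \<and> g \<noteq> h \<and>
         (group.ord G g = group.ord G h \<or>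
          (\<exists>g'\<in>carrier G. \<exists>h'\<in>carrier G.
             group.ord G g' = group.ord G g \<and> group.ord G h' = group.ord G h \<and>
             g' \<noteq> h' \<and> g' \<otimes>\<^bsub>G\<^esub> h' = h' \<otimes>\<^bsub>G\<^esub> g'))} \<rparr>"

definition dominant_vertices :: "('a, 'b) pre_digraph \<Rightarrow> 'a set" where
  "dominant_vertices \<Gamma> = {v \<in> verts \<Gamma>. \<forall>w \<in> verts \<Gamma>. w \<noteq> v \<longrightarrow> v \<rightarrow>\<^bsub>\<Gamma>\<^esub> w}"

definition reduced_order_super_commuting_graph ::
    "('a, 'b) monoid_scheme \<Rightarrow> ('a, 'a \<times> 'a) pre_digraph" where
  "reduced_order_super_commuting_graph G =
     (let \<Gamma> = with_proj (order_super_commuting_graph G)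
      in \<Gamma> \<restriction> (verts \<Gamma> - dominant_vertices \<Gamma>))"

text \<open>
  The distance is the least number of arcs on a walk, that is, the cost of a shortest walk for
  the weight that is constantly 1; it is infinite if there is no walk.
\<close>

definition graph_distance :: "('a, 'b) pre_digraph \<Rightarrow> 'a \<Rightarrow> 'a \<Rightarrow> ereal" where
  "graph_distance \<Gamma> u v = wf_digraph.\<mu> \<Gamma> (\<lambda>_. 1) u v"

text \<open>
  For a finite, nonempty vertex set the supremum below is a maximum.
\<close>

definition graph_diameter :: "('a, 'b) pre_digraph \<Rightarrow> ereal" where
  "graph_diameter \<Gamma> = (SUP u \<in> verts \<Gamma>. SUP v \<in> verts \<Gamma>. graph_distance \<Gamma> u v)"

lemma pair_graph_order_super_commuting_graph:
  assumes "finite (carrier G)"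
  shows "pair_graph (order_super_commuting_graph G)"
proof
  let ?D = "order_super_commuting_graph G"
  show "finite (pverts ?D)"
    using assms by (simp add: order_super_commuting_graph_def)
  show "finite (parcs ?D)"
    by (rule finite_subset[of _ "carrier G \<times> carrier G"])
       (use assms in \<open>auto simp: order_super_commuting_graph_def\<close>)
  show "symmetric (with_proj ?D)"
    unfolding symmetric_def with_proj_simps
    by (rule symI) (auto simp: order_super_commuting_graph_def, metis+)
qed (auto simp: order_super_commuting_graph_def)

lemma graph_reduced_order_super_commuting_graph:
  assumes "finite (carrier G)"
  shows "graph (reduced_order_super_commuting_graph G)"
proof -
  interpret D: pair_graph "order_super_commuting_graph G"
    using assms by (rule pair_graph_order_super_commuting_graph)
  let ?D = "with_proj (order_super_commuting_graph G)"
  have "induced_subgraph (?D \<restriction> (verts ?D - dominant_vertices ?D)) ?D"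
    by (rule D.induced_induce) auto
  then have "digraph (?D \<restriction> (verts ?D - dominant_vertices ?D))"
    and "sym_digraph (?D \<restriction> (verts ?D - dominant_vertices ?D))"
    by (auto intro: D.digraph_subgraph D.induced_graph_imp_graph)
  then show ?thesis
    unfolding reduced_order_super_commuting_graph_def Let_def
    by (simp add: graph_def pseudo_graph_def digraph_def)
qed

end

(*
An element of order d in S_n needs degree at least w(d), the sum of the prime powers exactly
dividing d, and degree w(d) suffices. So, for coprime d and e, some elements of orders d and e
commute only if w(d) + w(e) <= n. Adjacency in the graph is decided by such pairs of orders.

Upper bound: every nontrivial order commutes with some prime order r <= n/2, and two such primes
r, s commute with each other because r + s <= n.

Lower bound: an element of order p1^k1 p2^k2 has weight n, so every nontrivial order commuting with
it is divisible by p1 or p2. If e is coprime to p1 p2 and n - 5 < w(e) <= n, then no order divisible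
by p1 or p2 commutes with e; hence elements of these two orders are at distance at least 3, and only
the identity is dominant. Such an e is found greedily: below 24 a product of a power of 2 and a
power of 3 will do, and above that one takes a prime q in (n/2, n] other than p1, p2 and continues
with n - q < q. This needs three primes in (n/2, n], a strengthening of Bertrand's postulate.
*)
theory Submission
  imports Defs "HOL-Combinatorics.Orbits"
begin

section \<open>Three primes in the upper half of an interval\<close>

text \<open>Legendre's formula. Passing from \<open>n\<close> to \<open>Suc n\<close> raises
  \<open>n div p ^ i\<close> by one exactly when \<open>p ^ i\<close> divides \<open>Suc n\<close>,
  which happens for \<open>multiplicity p (Suc n)\<close> exponents. The free cutoff
  \<open>K\<close> lets the formulas for \<open>n\<close> and \<open>2 * n\<close> share one
  summation range.\<close>

lemma multiplicity_fact_nat: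
  fixes p :: nat
  assumes p: "prime p" and "n \<le> K"
  shows "multiplicity p (fact n) = (\<Sum>i\<in>{1..K}. n div p ^ i)"
  using assms(2)
proof (induction n)
  case 0
  then show ?case by simp
next
  case (Suc n)
  let ?m = "multiplicity p (Suc n)"
  have p2: "2 \<le> p" using p by (rule prime_ge_2_nat)
  have dvd_iff: "p ^ i dvd Suc n \<longleftrightarrow> i \<le> ?m" for i
    using p by (intro power_dvd_iff_le_multiplicity) auto
  have "?m < 2 ^ ?m" by (rule less_exp)
  also have "\<dots> \<le> p ^ ?m" using p2 by (intro power_mono) auto
  also have "\<dots> \<le> Suc n" using dvd_iff[of ?m] by (intro dvd_imp_le) auto
  finally have "?m \<le> K" using Suc.prems by simp
  then have eq: "{i\<in>{1..K}. p ^ i dvd Suc n} = {1..?m}"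
    by (auto simp: dvd_iff)
  have "(\<Sum>i\<in>{1..K}. Suc n div p ^ i) = (\<Sum>i\<in>{1..K}. n div p ^ i + (if p ^ i dvd Suc n then 1 else 0))"
    by (intro sum.cong) (auto simp: div_Suc mod_eq_0_iff_dvd)
  also have "\<dots> = multiplicity p (fact n) + card {i\<in>{1..K}. p ^ i dvd Suc n}"
    using Suc by (simp add: sum.distrib flip: sum.inter_filter)
  also have "\<dots> = multiplicity p (fact n) + ?m" by (simp only: eq) simp
  also have "\<dots> = multiplicity p (fact (Suc n))"
    unfolding fact_Suc of_nat_id
    using p by (subst prime_elem_multiplicity_mult_distrib) auto
  finally show ?case by simp
qed

text \<open>Legendre's formula applied to (2n)! = n! n! C(2n, n); subtraction of naturals is
  harmless because twice a floor never exceeds the floor of the double.\<close>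

lemma multiplicity_central_binomial:
  fixes p :: nat
  assumes p: "prime p"
  shows "multiplicity p (2 * n choose n) = (\<Sum>i\<in>{1..2 * n}. 2 * n div p ^ i - 2 * (n div p ^ i))"
proof -
  let ?C = "2 * n choose n"
  have "(fact (2 * n) :: nat) = fact n * fact n * ?C"
    using binomial_fact_lemma[of n "2 * n"] by (simp add: mult_2)
  then have "multiplicity p (fact (2 * n)) = multiplicity p (fact n) + multiplicity p (fact n) + multiplicity p ?C"
    using p by (simp add: prime_elem_multiplicity_mult_distrib)
  then have "multiplicity p ?C + 2 * (\<Sum>i\<in>{1..2 * n}. n div p ^ i) = (\<Sum>i\<in>{1..2 * n}. 2 * n div p ^ i)"
    using p by (simp add: multiplicity_fact_nat[where K = "2 * n"])
  then have "multiplicity p ?C = (\<Sum>i\<in>{1..2 * n}. 2 * n div p ^ i) - (\<Sum>i\<in>{1..2 * n}. 2 * (n div p ^ i))"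
    by (simp add: sum_distrib_left)
  also have "\<dots> = (\<Sum>i\<in>{1..2 * n}. 2 * n div p ^ i - 2 * (n div p ^ i))"
  proof (intro sum_subtractf_nat[symmetric])
    show "2 * (n div p ^ i) \<le> 2 * n div p ^ i" for i
      using prime_gt_0_nat[OF p] by (simp add: less_eq_div_iff_mult_less_eq mult.assoc)
  qed
  finally show ?thesis .
qed

lemma two_mult_div_le:
  fixes n d :: nat
  shows "2 * n div d - 2 * (n div d) \<le> (if d \<le> 2 * n then 1 else 0)"
proof (cases "d = 0")
  case False
  define q where "q = n div d"
  define r where "r = n mod d"
  have "n = q * d + r" "r < d" using False by (auto simp: q_def r_def)
  then have "2 * n div d = 2 * q + 2 * r div d"
    using False by (simp add: distrib_left mult.assoc[symmetric])
  moreover have "2 * r div d \<le> 1"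
    using \<open>r < d\<close> by (simp add: div_less_iff_less_mult flip: less_Suc_eq_le)
  moreover have "2 * n div d = 0" if "\<not> d \<le> 2 * n" using that by simp
  ultimately show ?thesis by (auto simp: q_def)
qed simp

text \<open>Each exponent \<open>i\<close> contributes at most 1 to the multiplicity, and only while
  \<open>p ^ i\<close> is at most \<open>2 * n\<close>, so the multiplicity is bounded by the
  largest such exponent.\<close>

lemma prime_power_central_binomial_le:
  fixes p :: nat
  assumes p: "prime p" and n: "n > 0"
  shows "p ^ multiplicity p (2 * n choose n) \<le> 2 * n"
proof -
  define S where "S = {i\<in>{1..2 * n}. p ^ i \<le> 2 * n}"
  have fin: "finite S" by (simp add: S_def)
  have "multiplicity p (2 * n choose n) \<le> (\<Sum>i\<in>{1..2 * n}. if p ^ i \<le> 2 * n then 1 else 0)"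
    unfolding multiplicity_central_binomial[OF p] by (intro sum_mono two_mult_div_le)
  also have "\<dots> = card S" by (simp add: S_def flip: sum.inter_filter)
  finally have le: "multiplicity p (2 * n choose n) \<le> card S" .
  show ?thesis
  proof (cases "S = {}")
    case True
    then show ?thesis using le n by simp
  next
    case False
    then have "Max S \<in> S" using fin by simp
    have "S \<subseteq> {1..Max S}" using fin by (auto simp: S_def)
    then have "card S \<le> Max S" using card_mono[of "{1..Max S}" S] by simp
    then have "p ^ multiplicity p (2 * n choose n) \<le> p ^ Max S"
      using le prime_gt_0_nat[OF p] by (intro power_increasing) auto
    also have "\<dots> \<le> 2 * n" using \<open>Max S \<in> S\<close> by (simp add: S_def)
    finally show ?thesis .
  qed
qed

text \<open>Primes in (2n/3, n] cancel: only \<open>i = 1\<close> could contribute since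
  \<open>p ^ 2\<close> exceeds \<open>2 * n\<close>, and there the floors of n/p and 2n/p are 1 and
  2.\<close>

lemma multiplicity_central_binomial_eq_0:
  fixes p :: nat
  assumes p: "prime p" and "2 * n < 3 * p" "p \<le> n" "2 * n < p ^ 2"
  shows "multiplicity p (2 * n choose n) = 0"
proof -
  have "2 * n div p ^ i - 2 * (n div p ^ i) = 0" if "i \<in> {1..2 * n}" for i
  proof (cases "i = 1")
    case True
    have "n div p = 1" "2 * n div p = 2"
      using assms by (auto simp: div_nat_eqI)
    then show ?thesis using True by simp
  next
    case False
    then have "p ^ 2 \<le> p ^ i" using that prime_gt_0_nat[OF p] by (intro power_increasing) auto
    then show ?thesis using assms by simp
  qed
  then show ?thesis unfolding multiplicity_central_binomial[OF p] by simp
qed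

lemma prod_coprime_dvd:
  fixes f :: "'a \<Rightarrow> nat"
  assumes "finite A" "\<And>x. x \<in> A \<Longrightarrow> f x dvd m"
    and "\<And>x y. x \<in> A \<Longrightarrow> y \<in> A \<Longrightarrow> x \<noteq> y \<Longrightarrow> coprime (f x) (f y)"
  shows "prod f A dvd m"
  using assms
proof (induction A)
  case (insert x A)
  have "coprime (f x) (prod f A)"
    using insert by (intro prod_coprime_right) (metis insertCI)
  then show ?case using insert by (simp add: divides_mult)
qed simp

section \<open>Upper bounds for the primorial and the central binomial coefficient\<close>

definition primorial :: "nat \<Rightarrow> nat" where
  "primorial n = \<Prod>{p. prime p \<and> p \<le> n}"

text \<open>For odd n = 2m + 1, the primes in (m + 1, n] all divide C(n, m), which is at most 4^m,
  and the induction hypothesis covers those up to m + 1. An even n > 2 adds no prime.\<close>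

lemma primorial_le: "primorial n \<le> 4 ^ n"
proof (induction n rule: less_induct)
  case (less n)
  show ?case
  proof (cases "n \<le> 2")
    case True
    then have "{p. prime p \<and> p \<le> n} = (if n = 2 then {2} else {})"
      by (auto dest: prime_ge_2_nat)
    then show ?thesis by (simp add: primorial_def)
  next
    case False
    show ?thesis
    proof (cases "even n")
      case True
      then have "\<not> prime n" using False by (metis dvd_refl linorder_not_less primes_dvd_imp_eq two_is_prime_nat order_le_less)
      then have "{p. prime p \<and> p \<le> n} = {p. prime p \<and> p \<le> n - 1}"
        by (auto simp: le_less dest: prime_gt_0_nat)
      then have "primorial n = primorial (n - 1)" by (simp add: primorial_def)
      also have "\<dots> \<le> 4 ^ (n - 1)" using False by (intro less) auto
      also have "\<dots> \<le> 4 ^ n" by (intro power_increasing) auto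
      finally show ?thesis .
    next
      case odd: False
      then obtain m where m: "n = 2 * m + 1" by (auto elim: oddE)
      with False have "m > 0" by simp
      let ?A = "{p. prime p \<and> p \<le> m + 1}" and ?B = "{p. prime p \<and> m + 1 < p \<and> p \<le> n}"
      have "p dvd (n choose m)" if "p \<in> ?B" for p
      proof -
        have "p dvd fact m * fact (n - m) * (n choose m)"
          using that by (subst binomial_fact_lemma) (auto simp: m prime_dvd_fact_iff simp del: fact_Suc)
        then show ?thesis using that by (simp add: m prime_dvd_mult_iff prime_dvd_fact_iff del: fact_Suc)
      qed
      then have "\<Prod>?B dvd (n choose m)" by (intro prod_coprime_dvd) (auto intro: primes_coprime)
      then have 1: "\<Prod>?B \<le> (n choose m)" by (intro dvd_imp_le) (auto simp: m)
      \<comment> \<open>The coefficient occurs twice in its row, whose sum is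
        \<open>2 * 4 ^ m\<close>.\<close>
      have "2 * (n choose m) = (n choose m) + (n choose (m + 1))"
        using binomial_symmetric[of m n] by (simp add: m)
      also have "\<dots> = (\<Sum>k\<in>{m, m + 1}. n choose k)" by simp
      also have "\<dots> \<le> (\<Sum>k\<le>n. n choose k)" by (intro sum_mono2) (auto simp: m)
      also have "\<dots> = 2 * 4 ^ m" by (simp only: choose_row_sum) (simp add: m power_mult)
      finally have 2: "n choose m \<le> 4 ^ m" by simp
      have "{p. prime p \<and> p \<le> n} = ?A \<union> ?B" by (auto simp: m)
      then have "primorial n = \<Prod>(?A \<union> ?B)" by (simp add: primorial_def)
      also have "\<dots> = primorial (m + 1) * \<Prod>?B"
        unfolding primorial_def by (intro prod.union_disjoint) auto
      also have "\<dots> \<le> 4 ^ (m + 1) * 4 ^ m"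
        using 1 2 less[of "m + 1"] \<open>m > 0\<close> by (intro mult_mono) (auto simp: m)
      also have "\<dots> = 4 ^ n" by (simp add: m mult_2 flip: power_add)
      finally show ?thesis .
    qed
  qed
qed

text \<open>The primes are split by size. Those up to \<open>s\<close> and those above
  \<open>n\<close> contribute at most \<open>2 * n\<close> each; those between \<open>s\<close> and
  2n/3 occur at most once, so together they are bounded by a primorial; the remaining ones up to
  \<open>n\<close> do not occur.\<close>

lemma central_binomial_le:
  fixes n s :: nat
  assumes n: "n > 0" and s: "2 * n < (s + 1) ^ 2"
  shows "2 * n choose n \<le> (2 * n) ^ (s + card {p. prime p \<and> n < p \<and> p \<le> 2 * n}) * 4 ^ (2 * n div 3)"
proof -
  let ?C = "2 * n choose n"
  let ?D = "{p. prime p \<and> n < p \<and> p \<le> 2 * n}"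
  let ?A = "{p. prime p \<and> p \<le> s}"
  let ?B = "{p. prime p \<and> s < p \<and> p \<le> 2 * n div 3}"
  let ?f = "\<lambda>p. p ^ multiplicity p ?C"
  have le: "?f p \<le> 2 * n" if "prime p" for p
    using prime_power_central_binomial_le[OF that n] .
  have sq: "2 * n < p ^ 2" if "s < p" for p
  proof -
    have "(s + 1) ^ 2 \<le> p ^ 2" using that by (intro power_mono) auto
    with s show ?thesis by (rule less_le_trans)
  qed
  have one: "?f p \<le> p" if "prime p" "s < p" for p
  proof -
    have "p ^ multiplicity p ?C < p ^ 2" using le[OF that(1)] sq[OF that(2)] by simp
    then have "multiplicity p ?C < 2" using prime_gt_1_nat[OF that(1)] by simp
    then have "?f p \<le> p ^ 1" using prime_gt_0_nat[OF that(1)] by (intro power_increasing) auto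
    then show ?thesis by simp
  qed
  have fin: "finite ?A" "finite ?B" "finite (?D - ?A)" by auto
  have le2n: "p \<le> 2 * n" if "p \<in> prime_factors ?C" for p
  proof -
    have "multiplicity p ?C > 0" "prime p" using that by (auto simp: prime_factors_multiplicity)
    then have "p ^ 1 \<le> ?f p" using prime_gt_0_nat[of p] by (intro power_increasing) auto
    with le[OF \<open>prime p\<close>] show ?thesis by simp
  qed
  have "?C = (\<Prod>p\<in>prime_factors ?C. ?f p)"
    by (intro prime_factorization_nat) auto
  \<comment> \<open>Nothing bounds \<open>s\<close> from above, so \<open>?A\<close> may overlap
    \<open>?D\<close>; removing it keeps the three ranges disjoint. Primes in these ranges that do
    not divide \<open>?C\<close> contribute a factor 1.\<close>
  also have "\<dots> = (\<Prod>p\<in>?A \<union> ?B \<union> (?D - ?A). ?f p)"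
  proof (intro prod.mono_neutral_left ballI subsetI)
    fix p assume p: "p \<in> prime_factors ?C"
    then have "prime p" "multiplicity p ?C > 0" by (auto simp: prime_factors_multiplicity)
    with multiplicity_central_binomial_eq_0[of p n] sq[of p] le2n[OF p]
    show "p \<in> ?A \<union> ?B \<union> (?D - ?A)"
      by (force simp: not_le less_eq_div_iff_mult_less_eq)
  qed (auto simp: prime_factors_multiplicity)
  also have "\<dots> = (\<Prod>p\<in>?A \<union> ?B. ?f p) * (\<Prod>p\<in>?D - ?A. ?f p)"
    by (intro prod.union_disjoint) auto
  also have "(\<Prod>p\<in>?A \<union> ?B. ?f p) = (\<Prod>p\<in>?A. ?f p) * (\<Prod>p\<in>?B. ?f p)"
    by (intro prod.union_disjoint) auto
  also have "(\<Prod>p\<in>?A. ?f p) * (\<Prod>p\<in>?B. ?f p) * (\<Prod>p\<in>?D - ?A. ?f p)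
      \<le> (2 * n) ^ s * 4 ^ (2 * n div 3) * (2 * n) ^ card ?D"
  proof (intro mult_mono)
    have "(\<Prod>p\<in>?A. ?f p) \<le> (\<Prod>p\<in>?A. 2 * n)" by (intro prod_mono) (auto intro: le)
    also have "\<dots> = (2 * n) ^ card ?A" by simp
    also have "card ?A \<le> card {1..s}" by (intro card_mono) (auto dest: prime_gt_0_nat simp: Suc_le_eq)
    then have "(2 * n) ^ card ?A \<le> (2 * n) ^ s" using n by (intro power_increasing) auto
    finally show "(\<Prod>p\<in>?A. ?f p) \<le> (2 * n) ^ s" .
    have "(\<Prod>p\<in>?B. ?f p) \<le> \<Prod>?B" by (intro prod_mono) (auto intro: one)
    also have "\<dots> \<le> primorial (2 * n div 3)"
      unfolding primorial_def
      by (intro dvd_imp_le prod_dvd_prod_subset prod_pos) (auto dest: prime_gt_0_nat)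
    also have "\<dots> \<le> 4 ^ (2 * n div 3)" by (rule primorial_le)
    finally show "(\<Prod>p\<in>?B. ?f p) \<le> 4 ^ (2 * n div 3)" .
    have "(\<Prod>p\<in>?D - ?A. ?f p) \<le> (\<Prod>p\<in>?D - ?A. 2 * n)" by (intro prod_mono) (auto intro: le)
    also have "\<dots> = (2 * n) ^ card (?D - ?A)" by simp
    also have "\<dots> \<le> (2 * n) ^ card ?D" using n by (intro power_increasing card_mono) auto
    finally show "(\<Prod>p\<in>?D - ?A. ?f p) \<le> (2 * n) ^ card ?D" .
  qed auto
  finally show ?thesis by (simp add: power_add mult_ac)
qed

text \<open>Raising \<open>i\<close> by one at most doubles each of the two growing factors on the
  left, while the right side is multiplied by 4. The inequality first holds at
  \<open>i = 7\<close>.\<close>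

lemma central_binomial_exponent_le:
  fixes i :: nat
  assumes "i \<ge> 7"
  shows "3 * ((2 * i + 2) * (2 ^ (i + 1) + 2)) \<le> 4 ^ i"
  using assms
proof (induction i rule: dec_induct)
  case (step i)
  have "(2 * Suc i + 2) * (2 ^ (Suc i + 1) + 2) \<le> (2 * (2 * i + 2)) * (2 * (2 ^ (i + 1) + 2))"
    by (intro mult_mono) auto
  with step show ?case by simp
qed simp

text \<open>
  Erdos' argument for Bertrand's postulate: if there were at most two such primes, the
  upper bound for the central binomial coefficient would fall below \<open>4 ^ n / (2 * n)\<close>.
\<close>

lemma card_primes_between_double:
  fixes n :: nat
  assumes n: "n \<ge> 2 ^ 13"
  shows "card {p. prime p \<and> n < p \<and> p \<le> 2 * n} > 2"
proof (rule ccontr)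
  let ?D = "{p. prime p \<and> n < p \<and> p \<le> 2 * n}"
  assume "\<not> card ?D > 2"
  \<comment> \<open>Bracketing \<open>2 * n\<close> between powers of 4 makes
    \<open>2 ^ (i + 1)\<close> an upper bound for its square root and turns the estimate into one
    between exponents of 4. The bound \<open>2 ^ 13\<close> on \<open>n\<close> yields
    \<open>i \<ge> 7\<close>.\<close>
  have "\<exists>i. 4 ^ i \<le> 2 * n \<and> 2 * n < 4 ^ (i + 1)"
    using n ex_power_ivl1[of 4 "2 * n"] by simp
  then obtain i where i: "4 ^ i \<le> 2 * n" "2 * n < 4 ^ (i + 1)" by blast
  have "(4::nat) ^ 7 \<le> 2 * n" using n by simp
  also have "\<dots> < 4 ^ (i + 1)" by fact
  finally have "7 < i + 1" by (subst (asm) power_strict_increasing_iff) auto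
  then have "i \<ge> 7" by simp
  define s :: nat where "s = 2 ^ (i + 1) - 1"
  have s: "s + 1 = 2 ^ (i + 1)" by (simp add: s_def)
  have "((2::nat) ^ (i + 1)) ^ 2 = (2 ^ 2) ^ (i + 1)" by (simp only: mult.commute flip: power_mult)
  then have "((2::nat) ^ (i + 1)) ^ 2 = 4 ^ (i + 1)" by simp
  then have s2: "2 * n < (s + 1) ^ 2" using i s by simp
  have "(4::real) ^ n \<le> 2 * n * (2 * n choose n)"
    using central_binomial_lower_bound[of n] n by (simp add: field_simps)
  then have "4 ^ n \<le> 2 * n * (2 * n choose n)" 
    by (metis (mono_tags, lifting) of_nat_le_iff of_nat_mult of_nat_numeral of_nat_power)
  also have "\<dots> \<le> 2 * n * ((2 * n) ^ (s + card ?D) * 4 ^ (2 * n div 3))"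
    using central_binomial_le[OF _ s2] n by (intro mult_left_mono) auto
  also have "\<dots> = (2 * n) ^ (s + 1 + card ?D) * 4 ^ (2 * n div 3)"
    by simp
  also have "\<dots> \<le> (2 * n) ^ (2 ^ (i + 1) + 2) * 4 ^ (2 * n div 3)"
    using \<open>\<not> card ?D > 2\<close> n s by (intro mult_right_mono power_increasing) auto
  also have "\<dots> < (4 ^ (i + 1)) ^ (2 ^ (i + 1) + 2) * 4 ^ (2 * n div 3)"
    using i by (intro mult_strict_right_mono power_strict_mono) auto
  also have "\<dots> = 4 ^ ((i + 1) * (2 ^ (i + 1) + 2) + 2 * n div 3)"
    by (simp only: power_mult power_add)
  finally have "n < (i + 1) * (2 ^ (i + 1) + 2) + 2 * n div 3"
    by (subst (asm) power_strict_increasing_iff) auto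
  \<comment> \<open>From n < a + 2n/3 follows n < 3a; doubling prepares the comparison with
    \<open>4 ^ i \<le> 2 * n\<close>.\<close>
  then have "2 * n < 3 * ((2 * i + 2) * (2 ^ (i + 1) + 2))"
    by (simp add: algebra_simps)
  also have "\<dots> \<le> 4 ^ i" using \<open>i \<ge> 7\<close> by (rule central_binomial_exponent_le)
  finally show False using i by simp
qed

section \<open>Explicit primes for small arguments, and the combined statement\<close>

text \<open>In a proper factorization both factors would exceed \<open>s\<close>. With
  \<open>s\<close> given explicitly, primality of a numeral becomes a short finite check.\<close>

lemma prime_by_trial_division:
  fixes n s :: nat
  assumes "n > 1" "n < (s + 1) ^ 2" "\<forall>d\<in>{2..s}. \<not> d dvd n"
  shows "prime n"
proof (rule ccontr)
  assume "\<not> prime n"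
  then obtain a where a: "a dvd n" "a \<noteq> 1" "a \<noteq> n"
    using assms(1) by (auto simp: prime_nat_iff)
  then obtain b where ab: "n = a * b" by (auto elim: dvdE)
  have "a \<noteq> 0" "b \<noteq> 0" "b \<noteq> 1" using ab a assms(1) by (auto intro: ccontr)
  have "s < d" if "d dvd n" "d \<noteq> 0" "d \<noteq> 1" for d
    using assms(3) that by force
  then have "s + 1 \<le> a" "s + 1 \<le> b" using ab a \<open>a \<noteq> 0\<close> \<open>b \<noteq> 0\<close> \<open>b \<noteq> 1\<close>
    by (auto simp: Suc_le_eq)
  then have "(s + 1) * (s + 1) \<le> a * b" by (rule mult_le_mono)
  then show False using ab assms(2) by (simp add: power2_eq_square)
qed

abbreviation upper_half_primes :: "nat \<Rightarrow> nat set" where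
  "upper_half_primes r \<equiv> {p. prime p \<and> r < 2 * p \<and> p \<le> r}"

lemma card_upper_half_primes_small:
  fixes r :: nat
  assumes "24 \<le> r" "r < 2 ^ 14"
  shows "card (upper_half_primes r) > 2"
proof -
  have three: ?thesis
    if "prime a" "prime b" "prime c" "a < b" "b < c" "c \<le> r" "r < 2 * a" for a b c :: nat
  proof -
    have "card {a, b, c} \<le> card (upper_half_primes r)"
      using that by (intro card_mono) auto
    then show ?thesis using that by simp
  qed
  have primes4: "prime (17::nat)" "prime (19::nat)" "prime (23::nat)"
    by (rule prime_by_trial_division[where s = 4]; simp add: atLeastAtMost_upt)+
  have primes8: "prime (29::nat)" "prime (31::nat)" "prime (37::nat)" "prime (41::nat)" "prime
      (43::nat)" "prime (67::nat)" "prime (71::nat)" "prime (73::nat)"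
    by (rule prime_by_trial_division[where s = 8]; simp add: atLeastAtMost_upt)+
  have primes11: "prime (113::nat)" "prime (127::nat)" "prime (131::nat)"
    by (rule prime_by_trial_division[where s = 11]; simp add: atLeastAtMost_upt)+
  have primes19: "prime (199::nat)" "prime (211::nat)" "prime (223::nat)" "prime (383::nat)" "prime (389::nat)" "prime (397::nat)"
    by (rule prime_by_trial_division[where s = 19]; simp add: atLeastAtMost_upt)+
  have primes28: "prime (751::nat)" "prime (757::nat)" "prime (761::nat)"
    by (rule prime_by_trial_division[where s = 28]; simp add: atLeastAtMost_upt)+
  have primes38: "prime (1489::nat)" "prime (1493::nat)" "prime (1499::nat)"
    by (rule prime_by_trial_division[where s = 38]; simp add: atLeastAtMost_upt)+
  have primes54: "prime (2963::nat)" "prime (2969::nat)" "prime (2971::nat)"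
    by (rule prime_by_trial_division[where s = 54]; simp add: atLeastAtMost_upt)+
  have primes76: "prime (5897::nat)" "prime (5903::nat)" "prime (5923::nat)"
    by (rule prime_by_trial_division[where s = 76]; simp add: atLeastAtMost_upt)+
  have primes108: "prime (11779::nat)" "prime (11783::nat)" "prime (11789::nat)"
    by (rule prime_by_trial_division[where s = 108]; simp add: atLeastAtMost_upt)+
  note primes = primes4 primes8 primes11 primes19 primes28 primes38 primes54 primes76 primes108
  have assms': "24 \<le> r" "r < 23558" using assms by auto
  \<comment> \<open>A triple \<open>a < b < c\<close> of primes serves every \<open>r\<close> from
    \<open>c\<close> up to \<open>2 * a - 1\<close>. Each breakpoint after 24 is twice the least
    prime of the preceding triple and is no smaller than the largest prime of the next one.\<close>
  consider "24 \<le> r" "r < 34"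
    | "34 \<le> r" "r < 46"
    | "46 \<le> r" "r < 74"
    | "74 \<le> r" "r < 134"
    | "134 \<le> r" "r < 226"
    | "226 \<le> r" "r < 398"
    | "398 \<le> r" "r < 766"
    | "766 \<le> r" "r < 1502"
    | "1502 \<le> r" "r < 2978"
    | "2978 \<le> r" "r < 5926"
    | "5926 \<le> r" "r < 11794"
    | "11794 \<le> r" "r < 23558"
    using assms' not_less[of r 34] not_less[of r 46] not_less[of r 74] not_less[of r 134]
      not_less[of r 226] not_less[of r 398] not_less[of r 766] not_less[of r 1502] not_less[of
      r 2978] not_less[of r 5926] not_less[of r 11794]
    by satx
  then show ?thesis
  proof cases
    case 1 then show ?thesis by (intro three[of 17 19 23] primes) auto
  next
    case 2 then show ?thesis by (intro three[of 23 29 31] primes) auto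
  next
    case 3 then show ?thesis by (intro three[of 37 41 43] primes) auto
  next
    case 4 then show ?thesis by (intro three[of 67 71 73] primes) auto
  next
    case 5 then show ?thesis by (intro three[of 113 127 131] primes) auto
  next
    case 6 then show ?thesis by (intro three[of 199 211 223] primes) auto
  next
    case 7 then show ?thesis by (intro three[of 383 389 397] primes) auto
  next
    case 8 then show ?thesis by (intro three[of 751 757 761] primes) auto
  next
    case 9 then show ?thesis by (intro three[of 1489 1493 1499] primes) auto
  next
    case 10 then show ?thesis by (intro three[of 2963 2969 2971] primes) auto
  next
    case 11 then show ?thesis by (intro three[of 5897 5903 5923] primes) auto
  next
    case 12 then show ?thesis by (intro three[of 11779 11783 11789] primes) auto
  qed
qed

lemma card_upper_half_primes:
  assumes "r \<ge> 24"
  shows "card (upper_half_primes r) > 2"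
proof (cases "r < 2 ^ 14")
  case True
  with assms show ?thesis by (rule card_upper_half_primes_small)
next
  case False
  let ?n = "r div 2"
  have "2 < card {p. prime p \<and> ?n < p \<and> p \<le> 2 * ?n}"
    using False by (intro card_primes_between_double) auto
  \<comment> \<open>A prime above \<open>r div 2\<close> satisfies \<open>r < 2 * p\<close> for odd
    \<open>r\<close> as well.\<close>
  also have "\<dots> \<le> card (upper_half_primes r)"
    by (intro card_mono) auto
  finally show ?thesis .
qed

text \<open>Three candidates are what it takes to survive the exclusion of two primes.\<close>

lemma upper_half_prime_avoiding_two:
  fixes r p q :: nat
  assumes "r \<ge> 24"
  obtains s where "prime s" "r < 2 * s" "s \<le> r" "s \<noteq> p" "s \<noteq> q"
proof -
  have "\<not> upper_half_primes r \<subseteq> {p, q}"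
  proof
    assume "upper_half_primes r \<subseteq> {p, q}"
    then have "card (upper_half_primes r) \<le> card {p, q}" by (intro card_mono) auto
    also have "\<dots> \<le> 2" by (simp add: card_insert_if)
    finally show False using card_upper_half_primes[OF assms] by simp
  qed
  then show ?thesis using that by blast
qed

section \<open>Orders of permutations\<close>

text \<open>
  The least degree of a symmetric group that contains an element of order \<open>d\<close>:
  one disjoint cycle per prime power.
\<close>

definition prime_power_sum :: "nat \<Rightarrow> nat" where
  "prime_power_sum d = (\<Sum>p\<in>prime_factors d. p ^ multiplicity p d)"

lemma prime_power_sum_1 [simp]: "prime_power_sum 1 = 0" "prime_power_sum (Suc 0) = 0"
  by (simp_all add: prime_power_sum_def)

lemma prime_power_sum_prime_power:
  assumes "prime p" "k > 0"
  shows "prime_power_sum (p ^ k) = p ^ k"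
proof -
  have "prime_factors (p ^ k) = {p}"
    using assms by (simp add: prime_factorization_prime_power)
  then show ?thesis
    using assms by (simp add: prime_power_sum_def)
qed

lemma prime_power_sum_mult:
  assumes "coprime a b" "a > 0" "b > 0"
  shows "prime_power_sum (a * b) = prime_power_sum a + prime_power_sum b"
proof -
  have disj: "prime_factors a \<inter> prime_factors b = {}"
    using assms(1) by (auto simp: prime_factors_dvd dest: coprime_common_divisor not_prime_unit)
  have aux: "multiplicity p (x * y) = multiplicity p x"
    if "prime p" "\<not> p dvd y" "x > 0" "y > 0" for p x y :: nat
    using that by (simp add: prime_elem_multiplicity_mult_distrib not_dvd_imp_multiplicity_0)
  have nd: "\<not> p dvd b" if "p \<in> prime_factors a" for p
    using that disj assms by (auto simp: prime_factors_dvd)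
  have nd': "\<not> p dvd a" if "p \<in> prime_factors b" for p
    using that disj assms by (auto simp: prime_factors_dvd)
  have "prime_power_sum (a * b) = (\<Sum>p\<in>prime_factors a \<union> prime_factors b. p ^ multiplicity p (a * b))"
    using assms by (simp add: prime_power_sum_def prime_factors_product)
  also have "\<dots> = (\<Sum>p\<in>prime_factors a. p ^ multiplicity p (a * b)) + (\<Sum>p\<in>prime_factors b. p ^ multiplicity p (a * b))"
    using disj by (intro sum.union_disjoint) auto
  also have "(\<Sum>p\<in>prime_factors a. p ^ multiplicity p (a * b)) = prime_power_sum a"
    unfolding prime_power_sum_def
    using assms nd by (intro sum.cong refl) (simp add: aux in_prime_factors_imp_prime)
  also have "(\<Sum>p\<in>prime_factors b. p ^ multiplicity p (a * b)) = prime_power_sum b"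
    unfolding prime_power_sum_def
    using assms nd' by (intro sum.cong refl) (simp add: aux mult.commute[of a] in_prime_factors_imp_prime)
  finally show ?thesis .
qed

lemma prime_power_le_prime_power_sum:
  assumes "prime p" "p ^ k dvd d" "d > 0" "k > 0"
  shows "p ^ k \<le> prime_power_sum d"
proof -
  have "p dvd d" using assms by (meson dvd_power dvd_trans)
  then have "p \<in> prime_factors d" using assms by (auto simp: prime_factors_dvd)
  have "k \<le> multiplicity p d"
    using assms by (intro multiplicity_geI) auto
  then have "p ^ k \<le> p ^ multiplicity p d"
    using prime_gt_0_nat[OF assms(1)] by (intro power_increasing) auto
  also have "\<dots> \<le> prime_power_sum d"
    unfolding prime_power_sum_def using \<open>p \<in> prime_factors d\<close> by (intro member_le_sum) auto
  finally show ?thesis .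
qed

lemma two_primes_le_prime_power_sum:
  assumes "prime p" "prime q" "p \<noteq> q" "p dvd d" "q dvd d" "d > 0"
  shows "p + q \<le> prime_power_sum d"
proof -
  have le: "s \<le> s ^ multiplicity s d" if "prime s" "s dvd d" for s
  proof -
    have "s ^ 1 \<le> s ^ multiplicity s d"
      using that assms(6) prime_gt_0_nat[OF that(1)]
      by (intro power_increasing multiplicity_geI) auto
    then show ?thesis by simp
  qed
  have "p + q \<le> (\<Sum>s\<in>{p, q}. s ^ multiplicity s d)"
    using assms le[of p] le[of q] by simp
  also have "\<dots> \<le> prime_power_sum d"
    unfolding prime_power_sum_def using assms by (intro sum_mono2) (auto simp: prime_factors_dvd)
  finally show ?thesis .
qed

text \<open>Greedy construction by strong induction on \<open>r\<close>. The tolerance 5 matches the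
  lower bound on the excluded primes: adding either of them to such a weight exceeds
  \<open>r\<close>.\<close>

lemma ex_coprime_prime_power_sum_near:
  fixes p q r :: nat
  assumes pq: "prime p" "prime q" "5 \<le> p" "5 \<le> q"
  shows "\<exists>e>0. coprime e p \<and> coprime e q \<and> prime_power_sum e \<le> r \<and> r < prime_power_sum e + 5"
proof (induction r rule: less_induct)
  case (less r)
  have cop: "coprime (2 ^ a * 3 ^ b) t" if "prime t" "5 \<le> t" for a b t :: nat
    using primes_coprime[of 2 t] primes_coprime[of 3 t] that by auto
  have small: ?case if "prime_power_sum (2 ^ a * 3 ^ b) \<le> r" "r < prime_power_sum (2 ^ a * 3 ^ b) + 5" for a b
    using that cop pq by (intro exI[of _ "2 ^ a * 3 ^ b"]) auto
  have two: "prime_power_sum (2 ^ k) = 2 ^ k" if "k > 0" for k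
    using that by (intro prime_power_sum_prime_power) auto
  have three: "prime_power_sum (3 ^ k) = 3 ^ k" if "k > 0" for k
    using that by (intro prime_power_sum_prime_power) auto
  have both: "prime_power_sum (2 ^ a * 3 ^ b) = 2 ^ a + 3 ^ b" if "a > 0" "b > 0" for a b
    using that by (subst prime_power_sum_mult) (auto simp: two three primes_coprime)
  \<comment> \<open>Windows of length five starting at the weights 0, 4, 9, 4 + 9, 8 + 9 and 16 + 3;
    together they cover everything below 24.\<close>
  consider "r < 5" | "4 \<le> r" "r < 9" | "9 \<le> r" "r < 14" | "13 \<le> r" "r < 18" | "17 \<le> r" "r < 22"
    | "19 \<le> r" "r < 24" | "24 \<le> r" by linarith
  then show ?case
  proof cases
    case 1 then show ?thesis by (intro small[of 0 0]) auto
  next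
    case 2 then show ?thesis using two[of 2] by (intro small[of 2 0]) auto
  next
    case 3 then show ?thesis using three[of 2] by (intro small[of 0 2]) auto
  next
    case 4 then show ?thesis using both[of 2 2] by (intro small[of 2 2]) auto
  next
    case 5 then show ?thesis using both[of 3 2] by (intro small[of 3 2]) auto
  next
    case 6 then show ?thesis using both[of 4 1] by (intro small[of 4 1]) auto
  next
    case 7
    then obtain s where s: "prime s" "r < 2 * s" "s \<le> r" "s \<noteq> p" "s \<noteq> q"
      by (rule upper_half_prime_avoiding_two)
    have "r - s < r" using s prime_gt_0_nat[OF s(1)] by simp
    from less[OF this] obtain e where e: "e > 0" "coprime e p" "coprime e q"
      "prime_power_sum e \<le> r - s" "r - s < prime_power_sum e + 5" by blast
    \<comment> \<open>The weight of \<open>e\<close> is at most \<open>r - s < s\<close>, too small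
      for an order divisible by \<open>s\<close>.\<close>
    have "\<not> s dvd e"
      using prime_power_le_prime_power_sum[of s 1 e] s e by auto
    then have "coprime s e" using s by (simp add: prime_imp_coprime)
    then have "prime_power_sum (s * e) = s + prime_power_sum e"
      using prime_power_sum_prime_power[of s 1] s e by (simp add: prime_power_sum_mult prime_gt_0_nat)
    then show ?thesis
      using s e pq by (intro exI[of _ "s * e"]) (auto simp: primes_coprime prime_gt_0_nat)
  qed
qed

section \<open>Cycle lengths and the least degree for a given order\<close>

text \<open>The orbit size is the first return time \<open>funpow_dist1 f x x\<close>, and the
  action of powers on \<open>x\<close> depends only on the exponent modulo that time.\<close>

lemma funpow_fixes_iff_card_orbit_dvd:
  assumes "permutation f"
  shows "(f ^^ k) x = x \<longleftrightarrow> card (orbit f x) dvd k"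
proof -
  have self: "x \<in> orbit f x" using assms by (rule permutation_self_in_orbit)
  let ?l = "funpow_dist1 f x x"
  have "card (orbit f x) = ?l"
    unfolding orbit_conv_funpow_dist1[OF self]
    by (subst card_image[OF inj_on_funpow_dist1[OF self]]) simp
  moreover have "(f ^^ k) x = (f ^^ (k mod ?l)) x"
    using funpow_dist1_prop[OF self] by (rule funpow_mod_eq[symmetric])
  moreover have "(f ^^ (k mod ?l)) x \<noteq> x" if "k mod ?l \<noteq> 0"
    using that by (intro funpow_dist1_least) auto
  ultimately show ?thesis by (auto simp: dvd_eq_mod_eq_0)
qed

text \<open>Serves cycles whose length is divisible by several of the prime powers. The inductive
  step is (2 + a)(2 + b) \<ge> (2 + a) + (2 + b).\<close>

lemma sum_le_prod_nat:
  fixes f :: "'a \<Rightarrow> nat"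
  assumes "finite A" "\<And>x. x \<in> A \<Longrightarrow> 2 \<le> f x"
  shows "sum f A \<le> prod f A"
  using assms
proof (induction A)
  case (insert x A)
  show ?case
  proof (cases "A = {}")
    case False
    then obtain y where "y \<in> A" by blast
    then have "2 \<le> sum f A" using insert member_le_sum[of y A f] by fastforce
    then have "2 \<le> prod f A" using insert by simp
    moreover have "2 \<le> f x" using insert.prems by simp
    ultimately obtain a b where "f x = 2 + a" "prod f A = 2 + b" by (metis le_Suc_ex)
    then have "f x + prod f A \<le> f x * prod f A" by simp
    then show ?thesis using insert by simp
  qed (use insert in simp)
qed simp

lemma dvd_div_prime:
  fixes p d l :: nat
  assumes "prime p" "p dvd d" "l dvd d" "\<not> p ^ multiplicity p d dvd l"
  shows "l dvd d div p"
proof -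
  obtain c where c: "d = l * c" using assms(3) by (auto elim: dvdE)
  have "p dvd c"
  proof (rule ccontr)
    assume "\<not> p dvd c"
    then have "coprime (p ^ multiplicity p d) c"
      using assms(1) by (simp add: prime_imp_coprime)
    moreover have "p ^ multiplicity p d dvd l * c"
      unfolding c[symmetric] by (rule multiplicity_dvd)
    ultimately show False using assms(4) by (simp add: coprime_dvd_mult_left_iff)
  qed
  then show ?thesis using c assms(1) by (auto simp: prime_gt_0_nat elim!: dvdE)
qed

text \<open>Every prime power exactly dividing the order divides some cycle length. A cycle is at
  least as long as the product, hence the sum, of the prime powers assigned to it, and distinct
  cycles are disjoint subsets of \<open>S\<close>.\<close>

lemma prime_power_sum_le_of_period:
  fixes f :: "nat \<Rightarrow> nat"
  assumes f: "f permutes S" "finite S"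
    and d: "d > 0" "\<And>k. f ^^ k = id \<longleftrightarrow> d dvd k"
  shows "prime_power_sum d \<le> card S"
proof -
  let ?l = "\<lambda>x. card (orbit f x)" and ?P = "prime_factors d"
  have perm: "permutation f" using f by (auto simp: permutation_permutes)
  have l_dvd: "?l x dvd d" for x
    using d(2)[of d] by (simp flip: funpow_fixes_iff_card_orbit_dvd[OF perm])
  \<comment> \<open>Otherwise all cycle lengths would divide \<open>d div p\<close>, and the smaller
    power \<open>f ^^ (d div p)\<close> would already be the identity.\<close>
  have "\<exists>x\<in>S. p ^ multiplicity p d dvd ?l x" if "p \<in> ?P" for p
  proof (rule ccontr)
    assume *: "\<not> ?thesis"
    have p: "prime p" "p dvd d" using that by (auto simp: prime_factors_dvd)
    have "(f ^^ (d div p)) x = x" for x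
    proof (cases "x \<in> S")
      case True
      then have "?l x dvd d div p" using * p l_dvd by (intro dvd_div_prime) auto
      then show ?thesis by (simp add: funpow_fixes_iff_card_orbit_dvd[OF perm])
    next
      case False
      then have "f x = x" using f by (simp add: permutes_def)
      then have "(f ^^ k) x = x" for k by (induction k) auto
      then show ?thesis .
    qed
    then have "f ^^ (d div p) = id" by (auto simp: fun_eq_iff)
    then have "d dvd d div p" by (simp add: d)
    moreover have "d div p < d" using d p prime_gt_1_nat[of p] by simp
    moreover have "d div p > 0" using d p by (auto elim!: dvdE)
    ultimately show False by (auto dest: dvd_imp_le)
  qed
  then obtain g where g: "\<And>p. p \<in> ?P \<Longrightarrow> g p \<in> S \<and> p ^ multiplicity p d dvd ?l (g p)"
    by metis
  let ?O = "\<lambda>p. orbit f (g p)"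
  \<comment> \<open>Several primes may have chosen points of the same cycle, so the sum is grouped
    by cycles.\<close>
  have "prime_power_sum d = (\<Sum>O'\<in>?O ` ?P. \<Sum>p\<in>{p\<in>?P. ?O p = O'}. p ^ multiplicity p d)"
    unfolding prime_power_sum_def by (rule sum.image_gen) simp
  also have "\<dots> \<le> (\<Sum>O'\<in>?O ` ?P. card O')"
  proof (rule sum_mono)
    fix O' assume "O' \<in> ?O ` ?P"
    let ?Q = "{p\<in>?P. ?O p = O'}"
    have "(\<Sum>p\<in>?Q. p ^ multiplicity p d) \<le> (\<Prod>p\<in>?Q. p ^ multiplicity p d)"
    proof (rule sum_le_prod_nat)
      fix p assume "p \<in> ?Q"
      then have "prime p" "multiplicity p d > 0" by (auto simp: prime_factors_multiplicity)
      then have "p ^ 1 \<le> p ^ multiplicity p d"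
        using prime_gt_0_nat[of p] by (intro power_increasing) auto
      then show "2 \<le> p ^ multiplicity p d" using prime_ge_2_nat[OF \<open>prime p\<close>] by simp
    qed simp
    also have "\<dots> \<le> card O'"
    proof (rule dvd_imp_le)
      show "(\<Prod>p\<in>?Q. p ^ multiplicity p d) dvd card O'"
        using g by (intro prod_coprime_dvd)
          (fastforce, fastforce, auto intro!: primes_coprime simp: in_prime_factors_imp_prime)
      show "card O' > 0"
        using \<open>O' \<in> ?O ` ?P\<close> finite_orbit[OF permutation_self_in_orbit[OF perm]]
        by (auto simp: card_gt_0_iff orbit_nonempty)
    qed
    finally show "(\<Sum>p\<in>?Q. p ^ multiplicity p d) \<le> card O'" .
  qed
  also have "\<dots> = card (\<Union>(?O ` ?P))"
  proof (rule card_Union_disjoint[symmetric])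
    show "pairwise disjnt (?O ` ?P)"
    proof (rule pairwiseI)
      fix A B assume "A \<in> ?O ` ?P" "B \<in> ?O ` ?P" "A \<noteq> B"
      moreover have "orbit f z = A" if "z \<in> A" "A \<in> ?O ` ?P" for z A
        using that orbit_cyclic_eq3[OF cyclic_on_orbit'[OF perm]] by auto
      ultimately show "disjnt A B" unfolding disjnt_iff by metis
    qed
  qed (use finite_orbit[OF permutation_self_in_orbit[OF perm]] in auto)
  also have "\<dots> \<le> card S"
    using f g by (intro card_mono) (auto dest: permutes_orbit_subset)
  finally show ?thesis .
qed

section \<open>Construction of a permutation of given order\<close>

lemma funpow_comp_commute:
  assumes "f \<circ> g = g \<circ> f"
  shows "(f \<circ> g) ^^ k = f ^^ k \<circ> g ^^ k"
proof (induction k)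
  case (Suc k)
  have "g (f x) = f (g x)" for x using assms by (simp add: fun_eq_iff)
  then have "g ((f ^^ k) x) = (f ^^ k) (g x)" for x by (induction k) simp_all
  then show ?case using Suc by (simp add: fun_eq_iff)
qed simp

text \<open>Powers of the cycle rotate its list, and a rotation of a distinct list is trivial only
  for multiples of the length.\<close>

lemma cycle_of_list_funpow_eq_id_iff:
  assumes "distinct cs" "cs \<noteq> []"
  shows "cycle_of_list cs ^^ k = id \<longleftrightarrow> length cs dvd k"
proof
  assume "cycle_of_list cs ^^ k = id"
  then have "rotate k cs = cs" using cyclic_rotation[OF assms(1), of k] by simp
  then have "cs ! (k mod length cs) = cs ! 0"
    using assms nth_rotate[of 0 cs k] by simp
  then show "length cs dvd k"
    using assms by (subst (asm) nth_eq_iff_index_eq) (auto simp: dvd_eq_mod_eq_0)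
next
  assume "length cs dvd k"
  then obtain m where "k = length cs * m" by (auto elim: dvdE)
  then have "cycle_of_list cs ^^ k = id ^^ m"
    using cycle_is_id_root[OF assms(1)] by (simp flip: funpow_mult)
  then show "cycle_of_list cs ^^ k = id" by (simp add: id_funpow)
qed

lemma permutes_disjoint_commute:
  assumes "f permutes A" "g permutes B" "A \<inter> B = {}"
  shows "f \<circ> g = g \<circ> f"
proof
  fix x
  consider "x \<in> A" | "x \<in> B" | "x \<notin> A" "x \<notin> B" by blast
  then show "(f \<circ> g) x = (g \<circ> f) x"
  proof cases
    case 1
    then have "f x \<in> A" using assms by (simp add: permutes_in_image)
    then show ?thesis using 1 assms by (auto simp: permutes_not_in disjoint_iff)
  next
    case 2
    then have "g x \<in> B" using assms by (simp add: permutes_in_image)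
    then have "g x \<notin> A" "x \<notin> A" using 2 assms by auto
    then show ?thesis using 2 assms by (auto simp: permutes_not_in)
  qed (use assms in \<open>auto simp: permutes_not_in\<close>)
qed

text \<open>On \<open>B\<close> the power of \<open>g\<close> takes values in \<open>B\<close>,
  where the power of \<open>f\<close> does nothing; hence a trivial product forces both powers to be
  trivial.\<close>

lemma funpow_comp_disjoint_eq_id_iff:
  assumes "f permutes A" "g permutes B" "A \<inter> B = {}"
  shows "(f \<circ> g) ^^ k = id \<longleftrightarrow> f ^^ k = id \<and> g ^^ k = id"
proof
  assume eq: "(f \<circ> g) ^^ k = id"
  have fk: "f ^^ k permutes A" and gk: "g ^^ k permutes B"
    using assms by (auto intro: permutes_funpow)
  have comp: "f ^^ k \<circ> g ^^ k = id"
    using eq funpow_comp_commute[OF permutes_disjoint_commute[OF assms]] by simp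
  have "(g ^^ k) x = x" for x
  proof (cases "x \<in> B")
    case True
    then have "(g ^^ k) x \<notin> A" using gk assms(3) by (auto simp: permutes_in_image)
    then have "(f ^^ k) ((g ^^ k) x) = (g ^^ k) x" using fk by (simp add: permutes_not_in)
    then show ?thesis using comp by (auto simp: fun_eq_iff)
  next
    case False
    then show ?thesis using gk by (simp add: permutes_not_in)
  qed
  then have "g ^^ k = id" by auto
  with comp show "f ^^ k = id \<and> g ^^ k = id" by simp
qed (use funpow_comp_commute[OF permutes_disjoint_commute[OF assms]] in simp)

text \<open>One prime power is split off at a time and realized as a cycle on fresh points.
  Describing the order through the trivial powers of \<open>f\<close> leaves the degree free to grow
  during the induction.\<close>

lemma ex_permutation_of_period:
  assumes "d > 0"
  shows "\<exists>f. f permutes {1..prime_power_sum d} \<and> (\<forall>k. f ^^ k = id \<longleftrightarrow> d dvd k)"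
  using assms
proof (induction d rule: less_induct)
  case (less d)
  show ?case
  proof (cases "d = 1")
    case True
    moreover have "(id :: nat \<Rightarrow> nat) ^^ k = id" for k by (induction k) auto
    ultimately show ?thesis by (metis one_dvd permutes_id)
  next
    case False
    then obtain p where p: "prime p" "p dvd d" using prime_factor_nat by blast
    have "d \<noteq> 0" using less.prems by simp
    then obtain c where c: "d = p ^ multiplicity p d * c" "\<not> p dvd c"
      using p by (auto intro: multiplicity_decompose'[of d p])
    let ?q = "p ^ multiplicity p d"
    have v: "multiplicity p d > 0"
      using p \<open>d \<noteq> 0\<close> by (simp add: prime_multiplicity_gt_zero_iff)
    then have "p ^ 1 \<le> ?q" using prime_gt_0_nat[OF p(1)] by (intro power_increasing) auto
    then have q: "?q > 1" using prime_gt_1_nat[OF p(1)] by simp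
    have "c > 0" using c \<open>d \<noteq> 0\<close> by (auto intro: Nat.gr0I)
    have "c < ?q * c" using q \<open>c > 0\<close> by simp
    then have "c < d" using c by simp
    from less.IH[OF this \<open>c > 0\<close>] obtain f where
      f: "f permutes {1..prime_power_sum c}" "\<And>k. f ^^ k = id \<longleftrightarrow> c dvd k" by blast
    have cop: "coprime ?q c" using p c by (simp add: prime_imp_coprime)
    have sum: "prime_power_sum d = prime_power_sum c + ?q"
      using prime_power_sum_mult[OF cop _ \<open>c > 0\<close>] prime_power_sum_prime_power[OF p(1) v]
        prime_gt_0_nat[OF p(1)] by (simp flip: c(1))
    \<comment> \<open>The block of \<open>?q\<close> points directly after the support interval of
      \<open>f\<close>.\<close>
    define cs where "cs = [prime_power_sum c + 1..<prime_power_sum d + 1]"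
    have cs: "distinct cs" "cs \<noteq> []" "length cs = ?q"
      "set cs = {prime_power_sum c + 1..prime_power_sum d}"
      using sum q by (auto simp: cs_def)
    let ?g = "cycle_of_list cs"
    have g: "?g permutes {prime_power_sum c + 1..prime_power_sum d}"
      using cycle_permutes[of cs] cs by simp
    have "f \<circ> ?g permutes {1..prime_power_sum d}"
      using f(1) g sum by (intro permutes_compose) (auto elim!: permutes_subset)
    moreover have "(f \<circ> ?g) ^^ k = id \<longleftrightarrow> d dvd k" for k
    proof -
      have "(f \<circ> ?g) ^^ k = id \<longleftrightarrow> c dvd k \<and> ?q dvd k"
        using funpow_comp_disjoint_eq_id_iff[OF f(1) g] cycle_of_list_funpow_eq_id_iff[OF cs(1,2)]
        by (simp add: f(2) cs(3))
      also have "\<dots> \<longleftrightarrow> d dvd k"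
        using cop c(1) by (metis divides_mult dvd_mult_left dvd_mult_right)
      finally show ?thesis .
    qed
    ultimately show ?thesis by blast
  qed
qed

section \<open>Transfer to the symmetric group\<close>

lemma sym_group_nat_pow: "f [^]\<^bsub>sym_group n\<^esub> (k::nat) = f ^^ k"
proof (induction k)
  case (Suc k)
  then show ?case
    by (simp add: sym_group_mult funpow_swap1 fun_eq_iff)
qed (simp add: sym_group_one)

lemma finite_carrier_sym_group: "finite (carrier (sym_group n))"
  by (simp add: sym_group_def finite_permutations)

lemma sym_group_funpow_eq_id_iff:
  assumes "f \<in> carrier (sym_group n)"
  shows "f ^^ k = id \<longleftrightarrow> group.ord (sym_group n) f dvd k"
  using group.pow_eq_id[OF sym_group_is_group assms, of k]
  by (simp add: sym_group_nat_pow sym_group_one)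

lemma ord_sym_group_pos:
  assumes "f \<in> carrier (sym_group n)"
  shows "group.ord (sym_group n) f > 0"
  using group.ord_ge_1[OF sym_group_is_group finite_carrier_sym_group assms] by simp

lemma prime_power_sum_ord_le:
  assumes "f \<in> carrier (sym_group n)"
  shows "prime_power_sum (group.ord (sym_group n) f) \<le> n"
proof -
  have "f permutes {1..n}" using assms by (simp add: sym_group_carrier)
  then show ?thesis
    using prime_power_sum_le_of_period[of f "{1..n}"] ord_sym_group_pos[OF assms]
      sym_group_funpow_eq_id_iff[OF assms] by simp
qed

lemma ex_sym_group_ord:
  assumes "d > 0" "prime_power_sum d \<le> n"
  obtains f where "f \<in> carrier (sym_group n)" "group.ord (sym_group n) f = d"
proof -
  obtain f where f: "f permutes {1..prime_power_sum d}" "\<And>k. f ^^ k = id \<longleftrightarrow> d dvd k"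
    using ex_permutation_of_period[OF assms(1)] by blast
  have carrier: "f \<in> carrier (sym_group n)"
    using permutes_subset[OF f(1)] assms(2) by (simp add: sym_group_carrier)
  then have "group.ord (sym_group n) f = d"
    using f(2) sym_group_funpow_eq_id_iff[OF carrier] by (metis dvd_antisym dvd_refl)
  with carrier show ?thesis by (rule that)
qed

lemma (in group) ord_mult_coprime:
  assumes xy: "x \<in> carrier G" "y \<in> carrier G" "x \<otimes> y = y \<otimes> x"
    and cop: "coprime (ord x) (ord y)"
  shows "ord (x \<otimes> y) = ord x * ord y"
proof (rule dvd_antisym)
  show "ord (x \<otimes> y) dvd ord x * ord y" using xy by (intro ord_mul_divides)
  have *: "ord x dvd ord (x \<otimes> y)"
    if "x \<in> carrier G" "y \<in> carrier G" "x \<otimes> y = y \<otimes> x" "coprime (ord x) (ord y)" for x y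
  proof -
    let ?m = "ord (x \<otimes> y)"
    \<comment> \<open>The exponent is a multiple of both \<open>ord (x \<otimes> y)\<close> and
      \<open>ord y\<close>, so it kills the product and \<open>y\<close>, hence also
      \<open>x\<close>; coprimality then removes the factor \<open>ord y\<close>.\<close>
    have "y [^] (?m * ord y) = \<one>" using that(2) by (simp only: pow_eq_id dvd_triv_right)
    then have "x [^] (?m * ord y) = x [^] (?m * ord y) \<otimes> y [^] (?m * ord y)"
      using that(1) by simp
    also have "\<dots> = (x \<otimes> y) [^] (?m * ord y)"
      using pow_mult_distrib[OF that(3,1,2)] by simp
    also have "\<dots> = \<one>" using that(1,2) by (simp only: pow_eq_id m_closed dvd_triv_left)
    finally have "ord x dvd ?m * ord y" using that(1) by (simp only: pow_eq_id)
    then show ?thesis using that(4) by (simp add: coprime_dvd_mult_left_iff)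
  qed
  have "ord x dvd ord (x \<otimes> y)" using * xy cop by blast
  moreover have "ord y dvd ord (x \<otimes> y)"
    using *[of y x] xy cop by (simp add: coprime_commute)
  ultimately show "ord x * ord y dvd ord (x \<otimes> y)" using cop by (simp add: divides_mult)
qed

section \<open>Orders of commuting permutations\<close>

text \<open>The witnesses may coincide. This absorbs the equal-order clause of adjacency, so that
  adjacency of distinct elements becomes a single relation between their orders.\<close>

definition commuting_orders :: "('a, 'b) monoid_scheme \<Rightarrow> nat \<Rightarrow> nat \<Rightarrow> bool" where
  "commuting_orders G d e \<longleftrightarrow> (\<exists>x\<in>carrier G. \<exists>y\<in>carrier G.
     group.ord G x = d \<and> group.ord G y = e \<and> x \<otimes>\<^bsub>G\<^esub> y = y \<otimes>\<^bsub>G\<^esub> x)"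

lemma commuting_orders_sym: "commuting_orders G d e \<Longrightarrow> commuting_orders G e d"
  unfolding commuting_orders_def by metis

lemma commuting_orders_refl: "x \<in> carrier G \<Longrightarrow> commuting_orders G (group.ord G x) (group.ord G x)"
  unfolding commuting_orders_def by blast

context group
begin

lemma ord_pow_div:
  assumes "x \<in> carrier G" "d dvd ord x" "ord x > 0"
  shows "ord (x [^] (ord x div d)) = d"
proof -
  have "ord (x [^] (ord x div d)) = ord x div (ord x div d)"
    using assms by (intro ord_pow) (auto elim!: dvdE)
  also have "\<dots> = d" using assms by (auto elim!: dvdE)
  finally show ?thesis .
qed

text \<open>A suitable power of \<open>y\<close> has order \<open>e'\<close> and still commutes with
  \<open>x\<close>.\<close>

lemma commuting_orders_dvd:
  assumes "commuting_orders G d e" "e' dvd e" "e > 0"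
  shows "commuting_orders G d e'"
proof -
  obtain x y where xy: "x \<in> carrier G" "y \<in> carrier G" "ord x = d" "ord y = e" "x \<otimes> y = y \<otimes> x"
    using assms(1) by (auto simp: commuting_orders_def)
  then have "ord (y [^] (e div e')) = e'" using ord_pow_div[of y e'] assms by simp
  then show ?thesis
    unfolding commuting_orders_def
    using xy group_commutes_pow[OF xy(5)[symmetric] xy(2,1), symmetric] nat_pow_closed by blast
qed

end

text \<open>The product of the two commuting elements has order \<open>d * e\<close>, whose weight
  is the sum of the weights and cannot exceed the degree.\<close>

lemma commuting_orders_sym_group_coprime:
  assumes "commuting_orders (sym_group n) d e" "coprime d e"
  shows "prime_power_sum d + prime_power_sum e \<le> n"
proof -
  let ?G = "sym_group n"
  obtain x y where xy: "x \<in> carrier ?G" "y \<in> carrier ?G" "group.ord ?G x = d" "group.ord ?G y = e"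
    "x \<otimes>\<^bsub>?G\<^esub> y = y \<otimes>\<^bsub>?G\<^esub> x"
    using assms(1) by (auto simp: commuting_orders_def)
  interpret group ?G by (rule sym_group_is_group)
  have "d > 0" "e > 0" using ord_sym_group_pos xy by auto
  then have "prime_power_sum d + prime_power_sum e = prime_power_sum (d * e)"
    using assms(2) by (simp add: prime_power_sum_mult)
  also have "\<dots> = prime_power_sum (ord (x \<otimes>\<^bsub>?G\<^esub> y))"
    using ord_mult_coprime[OF xy(1,2,5)] xy assms(2) by simp
  also have "\<dots> \<le> n" using xy by (intro prime_power_sum_ord_le) auto
  finally show ?thesis .
qed

text \<open>Both orders are realized by powers of a single element of order
  \<open>d\<close>.\<close>

lemma commuting_orders_sym_groupI:
  assumes "d > 0" "prime_power_sum d \<le> n" "a dvd d" "b dvd d"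
  shows "commuting_orders (sym_group n) a b"
proof -
  interpret group "sym_group n" by (rule sym_group_is_group)
  obtain f where "f \<in> carrier (sym_group n)" "ord f = d"
    using assms(1,2) by (rule ex_sym_group_ord)
  then have "commuting_orders (sym_group n) d d" using commuting_orders_refl by metis
  then show ?thesis using assms commuting_orders_dvd commuting_orders_sym by blast
qed

text \<open>Distinct primes are realized inside an element of order \<open>p * q\<close>, of weight
  \<open>p + q\<close>. The first hypothesis expresses that an element of order \<open>p\<close>
  exists and settles \<open>p = q\<close>.\<close>

lemma commuting_orders_sym_group_primes:
  assumes "commuting_orders (sym_group n) p p" "prime p" "prime q" "p + q \<le> n"
  shows "commuting_orders (sym_group n) p q"
proof (cases "p = q")
  case False
  then have "prime_power_sum (p * q) = p + q"
    using assms prime_power_sum_prime_power[of _ 1]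
    by (simp add: prime_power_sum_mult primes_coprime prime_gt_0_nat)
  then show ?thesis
    using assms by (intro commuting_orders_sym_groupI[of "p * q"]) (auto simp: prime_gt_0_nat)
qed (use assms in simp)

text \<open>If all prime divisors of the order exceed n/2, the weight bound leaves room for only one
  of them, to the first power. This prime is neither \<open>n\<close> nor \<open>n - 1\<close>, so
  two points remain for a disjoint transposition and \<open>r = 2\<close> works.\<close>

lemma ex_small_prime_commuting_order:
  assumes n: "n > 3" "\<not> prime n" "\<not> prime (n - 1)"
    and g: "g \<in> carrier (sym_group n)" "g \<noteq> id"
  shows "\<exists>r. prime r \<and> 2 * r \<le> n \<and> commuting_orders (sym_group n) (group.ord (sym_group n) g) r"
proof -
  interpret group "sym_group n" by (rule sym_group_is_group)
  let ?d = "ord g"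
  have pos: "?d > 0" using g by (intro ord_sym_group_pos)
  have le: "prime_power_sum ?d \<le> n" using g by (intro prime_power_sum_ord_le)
  show ?thesis
  proof (cases "\<exists>r. prime r \<and> r dvd ?d \<and> 2 * r \<le> n")
    case True
    then show ?thesis
      using commuting_orders_dvd[OF commuting_orders_refl[OF g(1)] _ pos] by blast
  next
    case False
    have "?d \<noteq> 1" using g ord_eq_1[OF g(1)] by (simp add: sym_group_one)
    then obtain p where p: "prime p" "p dvd ?d" using prime_factor_nat by blast
    then have large: "n < 2 * p" using False by auto
    obtain c where c: "?d = p * c" using p by (auto elim: dvdE)
    have "c = 1"
    proof (rule ccontr)
      assume "c \<noteq> 1"
      then obtain q where q: "prime q" "q dvd c" using prime_factor_nat by blast
      then have "q dvd ?d" using c by simp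
      then have "n < 2 * q" using False q by auto
      show False
      proof (cases "p = q")
        case True
        then have "p ^ 2 dvd ?d" using q c by (simp add: power2_eq_square)
        then have "p ^ 2 \<le> n" using prime_power_le_prime_power_sum[OF p(1) _ pos, of 2] le by simp
        then have "p * p < 2 * p" using large unfolding power2_eq_square by linarith
        then show False using prime_ge_2_nat[OF p(1)] by simp
      next
        case False
        then show False
          using two_primes_le_prime_power_sum[OF p(1) q(1) _ p(2) \<open>q dvd ?d\<close> pos] le
            large \<open>n < 2 * q\<close> by simp
      qed
    qed
    then have d: "?d = p" using c by simp
    have "p \<le> n" using prime_power_le_prime_power_sum[OF p(1) _ pos, of 1] p le by simp
    moreover have "p \<noteq> n" "p \<noteq> n - 1" using n p by auto
    ultimately have "p + 2 \<le> n" by simp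
    moreover have "commuting_orders (sym_group n) p p"
      using commuting_orders_refl[OF g(1)] d by simp
    ultimately have "commuting_orders (sym_group n) p 2"
      using commuting_orders_sym_group_primes[of n p 2] p by simp
    then show ?thesis using d n by (intro exI[of _ 2]) auto
  qed
qed

section \<open>Adjacency, distance and diameter\<close>

lemma pverts_order_super_commuting_graph [simp]: "pverts (order_super_commuting_graph G) = carrier G"
  by (simp add: order_super_commuting_graph_def)

lemma order_super_commuting_graph_arcs_iff:
  "(g, h) \<in> parcs (order_super_commuting_graph G) \<longleftrightarrow>
     g \<in> carrier G \<and> h \<in> carrier G \<and> g \<noteq> h \<and> commuting_orders G (group.ord G g) (group.ord G h)"
  unfolding order_super_commuting_graph_def commuting_orders_def
  by auto metis+

lemma (in wf_digraph) graph_distance_le: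
  assumes "awalk u p v"
  shows "graph_distance G u v \<le> length p"
proof -
  have "graph_distance G u v \<le> awalk_cost (\<lambda>_. 1) p"
    unfolding graph_distance_def using assms by (rule min_cost_le_walk_cost)
  also have "awalk_cost (\<lambda>_. 1) p = length p" by (induction p) auto
  finally show ?thesis by simp
qed

lemma (in wf_digraph) graph_distance_ge:
  assumes "\<And>p. awalk u p v \<Longrightarrow> k \<le> length p"
  shows "k \<le> graph_distance G u v"
  unfolding graph_distance_def \<mu>_def
proof (rule INF_greatest)
  fix p assume "p \<in> {p. awalk u p v}"
  then have "k \<le> length p" using assms by simp
  moreover have "awalk_cost (\<lambda>_. 1) p = length p" by (induction p) auto
  ultimately show "k \<le> ereal (awalk_cost (\<lambda>_. 1) p)" by simp
qed

lemma (in graph) connected_diameter_eqI: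
  assumes walks: "\<And>u v. u \<in> verts G \<Longrightarrow> v \<in> verts G \<Longrightarrow> \<exists>p. awalk u p v \<and> length p \<le> k"
    and far: "x \<in> verts G" "y \<in> verts G" "\<And>p. awalk x p y \<Longrightarrow> k \<le> length p"
  shows "Digraph_Component.connected G \<and> graph_diameter G = k"
proof
  show "Digraph_Component.connected G"
    using far(1) walks by (intro connectedI reachable_mk_symmetricI) (auto intro: reachable_awalkI)
  show "graph_diameter G = k"
    unfolding graph_diameter_def
  proof (rule antisym)
    show "(SUP u\<in>verts G. SUP v\<in>verts G. graph_distance G u v) \<le> k"
    proof (intro SUP_least)
      fix u v assume "u \<in> verts G" "v \<in> verts G"
      then obtain p where "awalk u p v" "length p \<le> k" using walks by blast
      then have "graph_distance G u v \<le> length p" by (intro graph_distance_le)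
      also have "\<dots> \<le> k" using \<open>length p \<le> k\<close> by simp
      finally show "graph_distance G u v \<le> k" .
    qed
    have "k \<le> graph_distance G x y" using far(3) by (rule graph_distance_ge)
    then show "k \<le> (SUP u\<in>verts G. SUP v\<in>verts G. graph_distance G u v)"
      using far(1,2) by (intro SUP_upper2[of x] SUP_upper2[of y]) auto
  qed
qed

section \<open>The diameter of the reduced graph\<close>

theorem corollary4p14:
  fixes n p1 p2 k1 k2 :: nat
  assumes "n \<ge> 20"
    and "\<not> prime n"
    and "\<not> prime (n - 1)"
    and "prime p1"
    and "prime p2"
    and "5 \<le> p1"
    and "p1 < p2"
    and "k1 > 0"
    and "k2 > 0"
    and "n = p1 ^ k1 + p2 ^ k2"
  shows "Digraph_Component.connected (reduced_order_super_commuting_graph (sym_group n)) \<and>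
         graph_diameter (reduced_order_super_commuting_graph (sym_group n)) = 3"
proof -
  let ?G = "sym_group n"
  let ?D = "order_super_commuting_graph ?G"
  let ?\<Gamma> = "reduced_order_super_commuting_graph ?G"
  let ?C = "commuting_orders ?G"
  interpret S: group ?G by (rule sym_group_is_group)
  interpret \<Gamma>: graph ?\<Gamma>
    using finite_carrier_sym_group by (rule graph_reduced_order_super_commuting_graph)

  define m where "m = p1 ^ k1 * p2 ^ k2"
  have p_pos: "p1 > 0" "p2 > 0" using assms by auto
  have "p1 \<noteq> p2" using assms by simp
  have m: "m > 0" "prime_power_sum m = n"
  proof -
    have "coprime (p1 ^ k1) (p2 ^ k2)" using assms \<open>p1 \<noteq> p2\<close> by (simp add: primes_coprime)
    then show "prime_power_sum m = n"
      unfolding m_def using assms p_pos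
      by (simp add: prime_power_sum_mult prime_power_sum_prime_power)
    show "m > 0" using p_pos by (simp add: m_def)
  qed
  obtain x where x: "x \<in> carrier ?G" "S.ord x = m"
    using m ex_sym_group_ord[of m n] by auto
  have "5 \<le> p2" using assms by simp
  then obtain e where e: "e > 0" "coprime e p1" "coprime e p2"
    "prime_power_sum e \<le> n" "n < prime_power_sum e + 5"
    using ex_coprime_prime_power_sum_near[of p1 p2 n] assms by blast
  obtain y where y: "y \<in> carrier ?G" "S.ord y = e"
    using e ex_sym_group_ord[of e n] by auto

  \<comment> \<open>The weight of \<open>m\<close> is already \<open>n\<close>, whereas every order
    other than 1 has positive weight, so none coprime to \<open>m\<close> fits beside it.\<close>
  have near_x: "p1 dvd d \<or> p2 dvd d" if C: "?C m d" and "d \<noteq> 1" for d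
  proof (rule ccontr)
    assume nd: "\<not> (p1 dvd d \<or> p2 dvd d)"
    then have cop: "coprime m d"
      using assms by (simp add: m_def prime_imp_coprime)
    obtain z where z: "z \<in> carrier ?G" "S.ord z = d" using C by (auto simp: commuting_orders_def)
    obtain r where r: "prime r" "r dvd d" using \<open>d \<noteq> 1\<close> prime_factor_nat by blast
    have "d > 0" using ord_sym_group_pos[OF z(1)] z by simp
    then have "prime_power_sum d > 0"
      using prime_power_le_prime_power_sum[of r 1 d] r prime_gt_0_nat[of r] by simp
    then show False using commuting_orders_sym_group_coprime[OF C cop] m by simp
  qed
  \<comment> \<open>If such a prime \<open>p\<close> divided \<open>d\<close>, then \<open>e\<close>
    would commute with order \<open>p\<close>, but the weights add up to at least
    \<open>prime_power_sum e + 5 > n\<close>.\<close>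
  have near_y: "\<not> p1 dvd d" "\<not> p2 dvd d" if C: "?C d e" for d
  proof -
    obtain z where z: "z \<in> carrier ?G" "S.ord z = d" using C by (auto simp: commuting_orders_def)
    then have "d > 0" using ord_sym_group_pos[OF z(1)] by simp
    have "\<not> p dvd d" if p: "prime p" "5 \<le> p" "coprime e p" for p
    proof
      assume "p dvd d"
      then have "?C e p" using S.commuting_orders_dvd[OF commuting_orders_sym[OF C]] \<open>d > 0\<close> by simp
      then have "prime_power_sum e + prime_power_sum p \<le> n"
        using p(3) by (rule commuting_orders_sym_group_coprime)
      then show False using e p prime_power_sum_prime_power[of p 1] by simp
    qed
    then show "\<not> p1 dvd d" "\<not> p2 dvd d" using assms e by auto
  qed
  \<comment> \<open>Used for dominance, for \<open>x\<close> and \<open>y\<close> being nonadjacent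
    (with \<open>d = m\<close>), and for the absence of a common neighbour.\<close>
  have separated: "\<not> (?C m d \<and> ?C d e)" if "d \<noteq> 1" for d
    using near_x[OF _ that] near_y by blast
  have "m \<noteq> 1" "e \<noteq> 1" using m e assms by auto
  then have xy: "x \<noteq> id" "y \<noteq> id" using x y S.ord_eq_1 by (auto simp: sym_group_one)

  have C_one: "?C 1 (S.ord g)" if "g \<in> carrier ?G" for g
    unfolding commuting_orders_def using that by (intro bexI[of _ "\<one>\<^bsub>?G\<^esub>"] bexI[of _ g]) auto
  have dominant: "dominant_vertices (with_proj ?D) = {id}"
  proof (intro equalityI subsetI)
    fix g assume g: "g \<in> dominant_vertices (with_proj ?D)"
    then have car: "g \<in> carrier ?G"
      by (simp add: dominant_vertices_def)
    \<comment> \<open>Reflexivity supplies the case \<open>h = g\<close>, so \<open>g\<close> may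
      itself be \<open>x\<close> or \<open>y\<close>.\<close>
    have "?C (S.ord g) (S.ord h)" if "h \<in> carrier ?G" for h
    proof (cases "h = g")
      case False
      then have "(g, h) \<in> parcs ?D"
        using g that by (auto simp: dominant_vertices_def)
      then show ?thesis by (simp add: order_super_commuting_graph_arcs_iff)
    qed (use commuting_orders_refl[OF car] in simp)
    then have "?C m (S.ord g)" "?C (S.ord g) e"
      using x y commuting_orders_sym by blast+
    then have "S.ord g = 1" using separated by blast
    then show "g \<in> {id}" using S.ord_eq_1[OF car] by (simp add: sym_group_one)
  next
    fix g :: "nat \<Rightarrow> nat" assume "g \<in> {id}"
    then have "g = \<one>\<^bsub>?G\<^esub>" by (simp add: sym_group_one)
    then show "g \<in> dominant_vertices (with_proj ?D)"
      using C_one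
      by (auto simp: dominant_vertices_def order_super_commuting_graph_arcs_iff)
  qed
  have verts: "verts ?\<Gamma> = carrier ?G - {id}"
    by (simp add: reduced_order_super_commuting_graph_def dominant)
  have arcs: "(g, h) \<in> arcs ?\<Gamma> \<longleftrightarrow>
      g \<in> verts ?\<Gamma> \<and> h \<in> verts ?\<Gamma> \<and> g \<noteq> h \<and> ?C (S.ord g) (S.ord h)" for g h
    using verts
    by (auto simp: reduced_order_super_commuting_graph_def dominant order_super_commuting_graph_arcs_iff)
  have tail_head: "tail ?\<Gamma> = fst" "head ?\<Gamma> = snd"
    by (simp_all add: reduced_order_super_commuting_graph_def Let_def)

  \<comment> \<open>The empty walk is allowed because the intermediate vertices chosen below may
    coincide with each other or with the endpoints.\<close>
  have step: "\<exists>p. \<Gamma>.awalk g p h \<and> length p \<le> 1"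
    if "g \<in> verts ?\<Gamma>" "h \<in> verts ?\<Gamma>" "?C (S.ord g) (S.ord h)" for g h
  proof (cases "g = h")
    case True
    then show ?thesis using that(1) \<Gamma>.awalk_Nil_iff[of g h] by (intro exI[of _ "[]"]) simp
  next
    case False
    then have "(g, h) \<in> arcs ?\<Gamma>" using that by (simp only: arcs simp_thms)
    then have "\<Gamma>.awalk g [(g, h)] h"
      using \<Gamma>.arc_implies_awalk[of "(g, h)"] by (simp only: tail_head fst_conv snd_conv)
    then show ?thesis by (intro exI[of _ "[(g, h)]"]) simp
  qed
  have near_small: "\<exists>u\<in>verts ?\<Gamma>. \<exists>r. prime r \<and> 2 * r \<le> n \<and> S.ord u = r \<and> ?C (S.ord g) r"
    if g: "g \<in> verts ?\<Gamma>" for g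
  proof -
    obtain r where r: "prime r" "2 * r \<le> n" "?C (S.ord g) r"
      using ex_small_prime_commuting_order[of n g] g assms verts by auto
    then obtain u where u: "u \<in> carrier ?G" "S.ord u = r" by (auto simp: commuting_orders_def)
    then have "u \<noteq> id" using r S.ord_eq_1[OF u(1)] by (auto simp: sym_group_one)
    then show ?thesis using u r verts by blast
  qed
  have "Digraph_Component.connected ?\<Gamma> \<and> graph_diameter ?\<Gamma> = (3::nat)"
  proof (rule \<Gamma>.connected_diameter_eqI)
    fix g h assume gh: "g \<in> verts ?\<Gamma>" "h \<in> verts ?\<Gamma>"
    obtain u r where u: "u \<in> verts ?\<Gamma>" "prime r" "2 * r \<le> n" "S.ord u = r" "?C (S.ord g) r"
      using near_small[OF gh(1)] by blast
    obtain v s where v: "v \<in> verts ?\<Gamma>" "prime s" "2 * s \<le> n" "S.ord v = s" "?C (S.ord h) s"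
      using near_small[OF gh(2)] by blast
    have "?C r r" using commuting_orders_refl[of u ?G] u verts by simp
    \<comment> \<open>Both primes are at most n/2, so \<open>r + s \<le> n\<close>; this gives the
      middle step of the walk from \<open>g\<close> through \<open>u\<close> and \<open>v\<close> to
      \<open>h\<close>.\<close>
    then have "?C r s" using commuting_orders_sym_group_primes[of n r s] u v by simp
    obtain p where p: "\<Gamma>.awalk g p u" "length p \<le> 1" using step[of g u] gh u by auto
    obtain q where q: "\<Gamma>.awalk u q v" "length q \<le> 1" using step[of u v] \<open>?C r s\<close> u v by auto
    obtain t where t: "\<Gamma>.awalk v t h" "length t \<le> 1"
      using step[of v h] gh v commuting_orders_sym by blast
    have "\<Gamma>.awalk g (p @ q @ t) h" using p q t by (auto intro: \<Gamma>.awalk_appendI)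
    then show "\<exists>p. \<Gamma>.awalk g p h \<and> length p \<le> 3" using p q t by (intro exI[of _ "p @ q @ t"]) auto
  next
    show "x \<in> verts ?\<Gamma>" "y \<in> verts ?\<Gamma>" using x y xy verts by auto
  next
    fix p assume p: "\<Gamma>.awalk x p y"
    have not_me: "\<not> ?C m e" using separated[OF \<open>m \<noteq> 1\<close>] commuting_orders_refl[OF x(1)] x by auto
    show "3 \<le> length p"
    proof (rule ccontr)
      assume "\<not> 3 \<le> length p"
      then consider "p = []" | a where "p = [a]" | a b where "p = [a, b]"
        by (cases p; cases "tl p"; cases "tl (tl p)") auto
      then show False
      proof cases
        case 1
        then have "x = y" using p by (simp add: \<Gamma>.awalk_Nil_iff)
        then show False using not_me commuting_orders_refl[OF x(1)] x y by auto
      next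
        case 2
        then have "(x, y) \<in> arcs ?\<Gamma>"
          using p by (cases a) (auto simp: \<Gamma>.awalk_simps tail_head)
        then show False using not_me arcs x y by auto
      next
        case 3
        then obtain w where w: "(x, w) \<in> arcs ?\<Gamma>" "(w, y) \<in> arcs ?\<Gamma>"
          using p by (cases a; cases b) (auto simp: \<Gamma>.awalk_simps tail_head)
        \<comment> \<open>Only the identity has order 1, and it was deleted as dominant, so
          \<open>separated\<close> applies to the middle vertex.\<close>
        then have "w \<in> carrier ?G" "w \<noteq> id" using arcs verts by auto
        then have "S.ord w \<noteq> 1" using S.ord_eq_1 by (simp add: sym_group_one)
        then show False using separated w arcs x y by auto
      qed
    qed
  qed
  then show ?thesis by simp
qed

end
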